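(* Let $n\in\mathbb{N}$, let $\{y_i\}_{i=1}^N\subset(-1,1)$ be a set of snapshot points and $\{w_i\}_{i=1}^N\subset\mathbb{R}^+$ positive weights such that $(g,f)_D:=\sum_{i=1}^N g(y_i)f(y_i)w_i$ is an inner product on $\mathcal{P}^n([-1,1])$ and $\sum_{i=1}^N w_i=2$. Let $$e=\max_{q\in\mathcal{P}^n([-1,1])\setminus\{0\}}\left|\frac{\int_{-1}^1 q(y)^2\,dy-\sum_{i=1}^N q(y_i)^2 w_i}{\int_{-1}^1 q(y)^2\,dy}\right|$$ and assume $e<1$. Let $\alpha\in\mathcal{P}^n([-1,1];\mathbb{R}^N)$ be such that $$\Phi\alpha(y)=\psi(y)\ \text{ for any } y\in(-1,1)\quad\text{and}\quad \int_{-1}^1\|W^{-1}\alpha(y)\|_2^2\,dy\le\frac{n+1}{1-e},$$ and define $\Pi_n: C([-1,1];\mathbb{R}^m_{A_0})\to\mathcal{P}^n([-1,1];\mathbb{R}^m)$ by $(\Pi_n f)(y)=\sum_{i=1}^N\alpha_i(y)f(y_i)$. Then for any $f\in C([-1,1];\mathbb{R}^m_{A_0})$, $$\|f-\Pi_nf\|_{L^2(-1,1;\mathbb{R}^m_{A_0})}\le\left(\sqrt2+C_{\rm s}(n)\right)\min_{p_n\in\mathcal{P}^n([-1,1];\mathbb{R}^m)}\|f-p_n\|_{L^\infty(-1,1;\mathbb{R}^m_{A_0})},$$ where $C_{\rm s}(n)=\left(\frac{2n+2}{1-e}\right)^{1/2}$.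
   Context: $\mathcal{P}^n([-1,1])$ is the space of real polynomials of degree at most $n$ on $[-1,1]$; $\mathcal{P}^n([-1,1];\mathbb{R}^k)$ is the space of $\mathbb{R}^k$-valued functions whose components are in $\mathcal{P}^n([-1,1])$. $A_0\in\mathbb{R}^{m\times m}$ is a symmetric positive definite matrix, $\|z\|_{A_0}=(z^TA_0z)^{1/2}$, and $\mathbb{R}^m_{A_0}$ is $\mathbb{R}^m$ equipped with the norm $\|\cdot\|_{A_0}$. Accordingly $\|f\|_{L^2(-1,1;\mathbb{R}^m_{A_0})}=\left(\int_{-1}^1\|f(y)\|_{A_0}^2\,dy\right)^{1/2}$ and $\|f\|_{L^\infty(-1,1;\mathbb{R}^m_{A_0})}=\operatorname{ess\,sup}_{y\in(-1,1)}\|f(y)\|_{A_0}$. $W=\mathrm{diag}(\sqrt{w_1},\ldots,\sqrt{w_N})$. $\{P_j\}_{j=0}^n$ is a $(\cdot,\cdot)_D$-orthogonal basis of $\mathcal{P}^n([-1,1])$ normalized so that $\int_{-1}^1P_j(y)^2\,dy=1$ for every $j$. $\Phi\in\mathbb{R}^{(n+1)\times N}$ is the matrix whose rows are indexed by $j=0,\ldots,n$ and columns by $i=1,\ldots,N$, with entries $P_j(y_i)$, and $\psi(y)=(P_0(y),\ldots,P_n(y))^T\in\mathbb{R}^{n+1}$. A function $\alpha$ with the two required properties exists whenever $e<1$. *)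

theory Defs
  imports
    "HOL-Analysis.Analysis"
    "HOL-Probability.Essential_Supremum"
    "HOL-Computational_Algebra.Polynomial"
begin

text \<open>Scalar polynomials on \<open>[-1,1]\<close> are represented by the library type of real polynomials; this
  loses nothing, since a real polynomial is determined by its values on \<open>[-1,1]\<close>.\<close>

definition poly_space :: "nat \<Rightarrow> real poly set" where
  "poly_space n = {q. degree q \<le> n}"

text \<open>Vector-valued polynomials are functions; only the values on \<open>[-1,1]\<close> matter.\<close>

definition vec_poly_space :: "nat \<Rightarrow> (real \<Rightarrow> real ^ 'k) set" where
  "vec_poly_space n =
    {p. \<forall>i. \<exists>q \<in> poly_space n. \<forall>t\<in>{-1..1}. p t $ i = poly q t}"

definition sym_pos_def :: "real ^ 'm ^ 'm \<Rightarrow> bool" where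
  "sym_pos_def A \<longleftrightarrow> transpose A = A \<and> (\<forall>z. z \<noteq> 0 \<longrightarrow> z \<bullet> (A *v z) > 0)"

definition wnorm :: "real ^ 'm ^ 'm \<Rightarrow> real ^ 'm \<Rightarrow> real" where
  "wnorm A z = sqrt (z \<bullet> (A *v z))"

definition L2_norm :: "real ^ 'm ^ 'm \<Rightarrow> (real \<Rightarrow> real ^ 'm) \<Rightarrow> real" where
  "L2_norm A f = sqrt (LINT t:{-1..1}|lborel. (wnorm A (f t))\<^sup>2)"

text \<open>The essential supremum is extended-real valued. It is finite for functions that are continuous
  on \<open>[-1,1]\<close>, so that the conversion to \<^typ>\<open>real\<close> is harmless for them.\<close>

definition Linf_norm :: "real ^ 'm ^ 'm \<Rightarrow> (real \<Rightarrow> real ^ 'm) \<Rightarrow> real" where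
  "Linf_norm A f =
    real_of_ereal (esssup (restrict_space lborel {-1<..<1}) (\<lambda>t. ereal (wnorm A (f t))))"

definition discrete_form ::
    "('N::finite \<Rightarrow> real) \<Rightarrow> ('N \<Rightarrow> real) \<Rightarrow> real poly \<Rightarrow> real poly \<Rightarrow> real" where
  "discrete_form y w g f = (\<Sum>i\<in>UNIV. poly g (y i) * poly f (y i) * w i)"

definition inner_product_on ::
    "real poly set \<Rightarrow> (real poly \<Rightarrow> real poly \<Rightarrow> real) \<Rightarrow> bool" where
  "inner_product_on V B \<longleftrightarrow>
    (\<forall>f\<in>V. \<forall>g\<in>V. B f g = B g f) \<and>
    (\<forall>f\<in>V. \<forall>g\<in>V. \<forall>h\<in>V. B (f + g) h = B f h + B g h) \<and>
    (\<forall>c. \<forall>f\<in>V. \<forall>g\<in>V. B (smult c f) g = c * B f g) \<and>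
    (\<forall>f\<in>V. B f f \<ge> 0) \<and>
    (\<forall>f\<in>V. B f f = 0 \<longrightarrow> f = 0)"

text \<open>\<open>GREATEST\<close> (and \<open>LEAST\<close> below) denote the attained maximum (minimum), which exists
  here by compactness.\<close>

definition quad_error :: "nat \<Rightarrow> ('N::finite \<Rightarrow> real) \<Rightarrow> ('N \<Rightarrow> real) \<Rightarrow> real" where
  "quad_error n y w =
    (GREATEST r. \<exists>q \<in> poly_space n - {0}.
      r = \<bar>((LINT t:{-1..1}|lborel. (poly q t)\<^sup>2) - (\<Sum>i\<in>UNIV. (poly q (y i))\<^sup>2 * w i))
            / (LINT t:{-1..1}|lborel. (poly q t)\<^sup>2)\<bar>)"

text \<open>The polynomials \<open>P 0, \<dots>, P n\<close> form a vector-space basis of the polynomials of degree at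
  most \<open>n\<close>. The type of polynomials is not an instance of \<^class>\<open>real_vector\<close>, hence the explicit
  scalar multiplication.\<close>

lemma vector_space_poly: "vector_space (smult :: real \<Rightarrow> real poly \<Rightarrow> real poly)"
  by unfold_locales (simp_all add: smult_add_right smult_add_left)

definition is_poly_basis :: "nat \<Rightarrow> (nat \<Rightarrow> real poly) \<Rightarrow> bool" where
  "is_poly_basis n P \<longleftrightarrow>
    inj_on P {..n} \<and>
    \<not> module.dependent smult (P ` {..n}) \<and>
    module.span smult (P ` {..n}) = poly_space n"

text \<open>The basis in the construction: orthogonal for the discrete inner product, but normalized in
  the continuous \<open>L\<^sup>2\<close> norm.\<close>

definition normalized_orthogonal_basis ::
    "nat \<Rightarrow> ('N::finite \<Rightarrow> real) \<Rightarrow> ('N \<Rightarrow> real) \<Rightarrow> (nat \<Rightarrow> real poly) \<Rightarrow> bool" where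
  "normalized_orthogonal_basis n y w P \<longleftrightarrow>
    is_poly_basis n P \<and>
    (\<forall>j\<le>n. \<forall>k\<le>n. j \<noteq> k \<longrightarrow> discrete_form y w (P j) (P k) = 0) \<and>
    (\<forall>j\<le>n. (LINT t:{-1..1}|lborel. (poly (P j) t)\<^sup>2) = 1)"

text \<open>The \<open>(n+1) \<times> N\<close> matrix \<open>\<Phi>\<close> and the vector \<open>\<psi>(t)\<close> have rows indexed by \<open>j = 0, \<dots>, n\<close> with
  \<open>n\<close> a number and not a type; they are given by their rows, and used only for \<open>j \<le> n\<close>.\<close>

definition Phi_row :: "(nat \<Rightarrow> real poly) \<Rightarrow> ('N::finite \<Rightarrow> real) \<Rightarrow> nat \<Rightarrow> real ^ 'N" where
  "Phi_row P y j = (\<chi> i. poly (P j) (y i))"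

definition psi :: "(nat \<Rightarrow> real poly) \<Rightarrow> real \<Rightarrow> nat \<Rightarrow> real" where
  "psi P t j = poly (P j) t"

definition weight_matrix :: "('N::finite \<Rightarrow> real) \<Rightarrow> real ^ 'N ^ 'N" where
  "weight_matrix w = (\<chi> i j. if i = j then sqrt (w i) else 0)"

definition snapshot_op ::
    "(real \<Rightarrow> real ^ 'N) \<Rightarrow> ('N::finite \<Rightarrow> real) \<Rightarrow> (real \<Rightarrow> real ^ 'm) \<Rightarrow> real \<Rightarrow> real ^ 'm" where
  "snapshot_op \<alpha> y f t = (\<Sum>i\<in>UNIV. (\<alpha> t $ i) *\<^sub>R f (y i))"

lemma snapshot_op_in_vec_poly_space:
  fixes f :: "real \<Rightarrow> real ^ 'm"
  assumes "\<alpha> \<in> vec_poly_space n"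
  shows "snapshot_op \<alpha> y f \<in> vec_poly_space n"
proof -
  obtain a where a: "\<And>i. a i \<in> poly_space n" "\<And>i t. t \<in> {-1..1} \<Longrightarrow> \<alpha> t $ i = poly (a i) t"
    using assms unfolding vec_poly_space_def mem_Collect_eq Bex_def by metis
  have "\<exists>q \<in> poly_space n. \<forall>t\<in>{-1..1}. snapshot_op \<alpha> y f t $ k = poly q t" for k
  proof (intro bexI ballI)
    show "(\<Sum>i\<in>UNIV. smult (f (y i) $ k) (a i)) \<in> poly_space n"
      using a(1) by (auto simp: poly_space_def intro!: degree_sum_le
          intro: order_trans[OF degree_smult_le])
    show "snapshot_op \<alpha> y f t $ k = poly (\<Sum>i\<in>UNIV. smult (f (y i) $ k) (a i)) t"
      if "t \<in> {-1..1}" for t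
      using a(2)[OF that] by (simp add: snapshot_op_def poly_sum mult.commute)
  qed
  then show ?thesis by (simp add: vec_poly_space_def)
qed

definition best_approx_error ::
    "real ^ 'm ^ 'm \<Rightarrow> nat \<Rightarrow> (real \<Rightarrow> real ^ 'm) \<Rightarrow> real" where
  "best_approx_error A n f =
    (LEAST r. \<exists>p \<in> vec_poly_space n. r = Linf_norm A (\<lambda>t. f t - p t))"

definition C_s :: "nat \<Rightarrow> real \<Rightarrow> real" where
  "C_s n e = sqrt ((2 * real n + 2) / (1 - e))"

end

theory Submission
  imports Defs
begin

text \<open>
  The operator reproduces \<open>\<P>\<^sup>n\<close>: the identity \<open>\<Phi> \<alpha> = \<psi>\<close> says so for the basis polynomials, and
  continuity carries it over to the endpoints. If \<open>p\<close> is a best approximation, then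
  \<open>f - \<Pi> f = g - \<Pi> g\<close> for \<open>g = f - p\<close>. With \<open>M = \<parallel>g\<parallel>\<^sub>\<infinity>\<close> and \<open>\<beta> = \<parallel>W\<^sup>-\<^sup>1 \<alpha>\<parallel>\<close>, the
  Cauchy-Schwarz inequality and \<open>\<Sum> w\<^sub>i = 2\<close> give the pointwise bound
  \<open>\<parallel>g - \<Pi> g\<parallel> \<le> M (1 + \<surd>2 \<beta>)\<close>, which is squared and integrated.

  A best approximation exists because reproduction parametrizes the polynomials by their values at
  the snapshot points, as \<open>\<Sum> \<alpha>\<^sub>i v\<^sub>i\<close> with \<open>v\<close> in a Euclidean space; the values that matter lie in a
  compact set.
\<close>

subsection \<open>The weighted norm\<close>

lemma wnorm_nonneg: "sym_pos_def A \<Longrightarrow> 0 \<le> wnorm A z"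
  unfolding sym_pos_def_def wnorm_def by (cases "z = 0") (auto intro: less_imp_le)

lemma wnorm_power2: "sym_pos_def A \<Longrightarrow> (wnorm A z)\<^sup>2 = z \<bullet> (A *v z)"
  using wnorm_nonneg[of A z] unfolding wnorm_def by simp

lemma wnorm_zero [simp]: "wnorm A 0 = 0"
  by (simp add: wnorm_def)

lemma wnorm_scaleR: "wnorm A (c *\<^sub>R z) = \<bar>c\<bar> * wnorm A z"
proof -
  have "(c *\<^sub>R z) \<bullet> (A *v (c *\<^sub>R z)) = c\<^sup>2 * (z \<bullet> (A *v z))"
    by (simp add: matrix_vector_mult_scaleR power2_eq_square)
  then show ?thesis
    by (simp add: wnorm_def real_sqrt_mult)
qed

text \<open>The form is nonnegative at \<open>c *\<^sub>R x - b *\<^sub>R z\<close>, which is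
  \<open>c\<close> times the component of \<open>x\<close> that is orthogonal to \<open>z\<close>
  with respect to \<open>A\<close>.\<close>

lemma wnorm_Cauchy_Schwarz:
  assumes "sym_pos_def A"
  shows "x \<bullet> (A *v z) \<le> wnorm A x * wnorm A z"
proof (cases "z = 0")
  case False
  define a b c where "a = x \<bullet> (A *v x)" and "b = x \<bullet> (A *v z)" and "c = z \<bullet> (A *v z)"
  have c: "c > 0"
    using assms False unfolding sym_pos_def_def c_def by blast
  have sym: "z \<bullet> (A *v x) = b"
    using assms unfolding sym_pos_def_def b_def by (metis dot_lmul_matrix inner_commute vector_transpose_matrix)
  have "0 \<le> (wnorm A (c *\<^sub>R x - b *\<^sub>R z))\<^sup>2"
    by simp
  also have "\<dots> = c * (c * a - b\<^sup>2)"
    unfolding wnorm_power2[OF assms]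
    by (simp add: matrix_vector_mult_diff_distrib matrix_vector_mult_scaleR inner_diff_left
        inner_diff_right sym flip: a_def b_def c_def) (simp add: algebra_simps power2_eq_square)
  finally have "b\<^sup>2 \<le> a * c"
    using c by (simp add: zero_le_mult_iff mult.commute)
  then have "\<bar>b\<bar> \<le> sqrt (a * c)"
    by (metis real_sqrt_abs real_sqrt_le_mono)
  then show ?thesis
    unfolding wnorm_def a_def b_def c_def real_sqrt_mult by linarith
qed simp

lemma wnorm_triangle:
  assumes "sym_pos_def A"
  shows "wnorm A (x + z) \<le> wnorm A x + wnorm A z"
proof (rule power2_le_imp_le)
  have "(wnorm A (x + z))\<^sup>2 = (wnorm A x)\<^sup>2 + x \<bullet> (A *v z) + z \<bullet> (A *v x) + (wnorm A z)\<^sup>2"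
    unfolding wnorm_power2[OF assms]
    by (simp add: matrix_vector_right_distrib inner_add_left inner_add_right)
  also have "\<dots> \<le> (wnorm A x + wnorm A z)\<^sup>2"
    using wnorm_Cauchy_Schwarz[OF assms, of x z] wnorm_Cauchy_Schwarz[OF assms, of z x]
    by (simp add: power2_sum mult.commute[of "wnorm A z" "wnorm A x"])
  finally show "(wnorm A (x + z))\<^sup>2 \<le> (wnorm A x + wnorm A z)\<^sup>2" .
qed (simp add: wnorm_nonneg assms)

lemma wnorm_triangle_diff:
  assumes "sym_pos_def A"
  shows "wnorm A (x - z) \<le> wnorm A x + wnorm A z"
  using wnorm_triangle[OF assms, of x "- z"] wnorm_scaleR[of A "- 1" z] by simp

lemma wnorm_sum:
  assumes "sym_pos_def A"
  shows "wnorm A (\<Sum>i\<in>S. g i) \<le> (\<Sum>i\<in>S. wnorm A (g i))"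
proof (induction S rule: infinite_finite_induct)
  case (insert i S)
  then show ?case
    using wnorm_triangle[OF assms, of "g i" "\<Sum>i\<in>S. g i"] by simp
qed auto

lemma continuous_on_wnorm [continuous_intros]:
  "continuous_on S g \<Longrightarrow> continuous_on S (\<lambda>t. wnorm A (g t))"
  unfolding wnorm_def
  by (intro continuous_intros bounded_linear.continuous_on[OF matrix_vector_mul_bounded_linear])

text \<open>By homogeneity it suffices to look at the unit sphere, where compactness gives the
  continuous positive function \<open>wnorm A\<close> a positive minimum. The constant serves to
  bound the sets of candidate values in the existence proof below.\<close>

lemma norm_le_wnorm:
  fixes A :: "real ^ 'm ^ 'm"
  assumes "sym_pos_def A"
  obtains c where "c > 0" "\<And>z. norm z \<le> c * wnorm A z"
proof -
  have "sphere (0 :: real ^ 'm) 1 \<noteq> {}"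
    by simp
  then obtain x where x: "norm x = 1" "\<And>z. norm z = 1 \<Longrightarrow> wnorm A x \<le> wnorm A z"
    using continuous_attains_inf[OF compact_sphere, of "0 :: real ^ 'm" 1 "wnorm A"]
    by (auto simp: continuous_on_wnorm)
  have pos: "wnorm A x > 0"
    using assms x(1) unfolding sym_pos_def_def wnorm_def
    by (metis norm_zero real_sqrt_gt_zero zero_neq_one)
  have "norm z \<le> 1 / wnorm A x * wnorm A z" for z
  proof (cases "z = 0")
    case False
    then have "wnorm A x \<le> wnorm A (inverse (norm z) *\<^sub>R z)"
      by (intro x) simp
    then show ?thesis
      using False pos by (simp add: wnorm_scaleR field_simps)
  qed simp
  then show thesis
    using that pos by (metis zero_less_divide_1_iff)
qed

subsection \<open>The essential supremum of a continuous function\<close>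

text \<open>Continuity turns the essential supremum into a true supremum that includes the
  endpoints. All later reasoning about \<open>Linf_norm\<close> goes through this
  equivalence.\<close>

lemma Linf_norm_le_iff:
  fixes g :: "real \<Rightarrow> real ^ 'm"
  assumes A: "sym_pos_def A" and g: "continuous_on {-1..1} g"
  shows "Linf_norm A g \<le> r \<longleftrightarrow> (\<forall>t\<in>{-1..1}. wnorm A (g t) \<le> r)"
proof -
  let ?M = "restrict_space lborel {-1<..<1::real}"
  let ?h = "\<lambda>t. wnorm A (g t)"
  define s where "s = esssup ?M (\<lambda>t. ereal (?h t))"
  have cont: "continuous_on {-1..1} ?h"
    by (intro continuous_intros g)
  then have cont': "continuous_on {-1<..<1} ?h"
    by (rule continuous_on_subset) auto
  have meas: "(\<lambda>t. ereal (?h t)) \<in> borel_measurable ?M"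
    using borel_measurable_continuous_on_restrict[OF cont']
    by (simp add: measurable_cong_sets[OF sets_restrict_space_cong[OF sets_lborel] refl])
  have upper: "s \<le> ereal c" if "\<And>t. t \<in> {-1<..<1} \<Longrightarrow> ?h t \<le> c" for c
    unfolding s_def using that by (intro esssup_I[OF meas] AE_I2) (simp add: space_restrict_space)
  have AE_s: "AE t in lborel. t \<in> {-1<..<1} \<longrightarrow> ereal (?h t) \<le> s"
    using esssup_AE[of "\<lambda>t. ereal (?h t)" ?M] unfolding s_def
    by (subst (asm) AE_restrict_space_iff) auto
  \<comment> \<open>The set where \<open>?h\<close> exceeds \<open>c\<close> is open by continuity
    and null by the choice of \<open>s\<close>, and an open null set is empty.\<close>
  have lower: "?h t \<le> c" if "s \<le> ereal c" "t \<in> {-1<..<1}" for c t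
  proof (rule ccontr)
    assume *: "\<not> ?h t \<le> c"
    have "open ({-1<..<1} \<inter> ?h -` {c<..})"
      by (intro continuous_open_preimage cont' open_greaterThanLessThan open_greaterThan)
    moreover have "AE t in lborel. t \<in> {-1<..<1} \<inter> ?h -` {c<..} \<longrightarrow> t \<in> {}"
      using AE_s by eventually_elim (use that(1) in \<open>auto dest: order_trans\<close>)
    ultimately have "t \<in> {}"
      using * that(2) by (intro mem_closed_if_AE_lebesgue_open[OF _ closed_empty AE_completion]) auto
    then show False
      by simp
  qed
  \<comment> \<open>Since \<open>real_of_ereal\<close> sends both infinities to 0, \<open>s\<close>
    must be shown finite before it can be compared with \<open>Linf_norm A g\<close>.\<close>
  obtain B where "\<And>t. t \<in> {-1..1} \<Longrightarrow> ?h t \<le> B"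
    using compact_continuous_image[OF cont compact_Icc]
    by (meson bounded_imp_bdd_above bdd_above.E compact_imp_bounded imageI)
  then have "s \<le> ereal B"
    by (intro upper) auto
  moreover have "s \<ge> 0"
  proof (rule ccontr)
    assume "\<not> s \<ge> 0"
    then obtain c where "s \<le> ereal c" "c < 0"
      by (meson ereal_dense2 less_eq_ereal_def not_le zero_ereal_def ereal_less(1) less_ereal.simps(1))
    then show False
      using lower[of c 0] wnorm_nonneg[OF A, of "g 0"] by simp
  qed
  ultimately obtain L where L: "s = ereal L"
    by (cases s) auto
  then have "Linf_norm A g = L"
    by (simp add: Linf_norm_def s_def)
  then have "Linf_norm A g \<le> r \<longleftrightarrow> (\<forall>t\<in>{-1<..<1}. ?h t \<le> r)"
    using upper[of r] lower[of r] L by auto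
  also have "\<dots> \<longleftrightarrow> (\<forall>t\<in>{-1..1}. ?h t \<le> r)"
    using continuous_le_on_closure[of "{-1<..<1}" ?h _ r] cont by auto
  finally show ?thesis .
qed

subsection \<open>Reproduction of polynomials\<close>

lemma continuous_on_vec_poly_space:
  assumes "p \<in> vec_poly_space n"
  shows "continuous_on {-1..1} p"
proof -
  have "continuous_on {-1..1} (\<lambda>t. p t $ i)" for i
  proof -
    obtain q where "\<And>t. t \<in> {-1..1} \<Longrightarrow> p t $ i = poly q t"
      using assms unfolding vec_poly_space_def by blast
    then show ?thesis
      by (intro continuous_on_eq[OF continuous_on_poly[OF continuous_on_id]]) simp
  qed
  then have "continuous_on {-1..1} (\<lambda>t. \<chi> i. p t $ i)"
    by (rule continuous_on_vec_lambda)
  then show ?thesis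
    by simp
qed

lemma reproduces_poly:
  fixes y :: "'N::finite \<Rightarrow> real"
  assumes P: "is_poly_basis n P"
    and \<alpha>: "\<alpha> \<in> vec_poly_space n"
    and eq: "\<And>t j. t \<in> {-1<..<1} \<Longrightarrow> j \<le> n \<Longrightarrow> Phi_row P y j \<bullet> \<alpha> t = psi P t j"
    and q: "q \<in> poly_space n" and t: "t \<in> {-1..1}"
  shows "(\<Sum>i\<in>UNIV. \<alpha> t $ i * poly q (y i)) = poly q t"
proof -
  interpret vs: vector_space "smult :: real \<Rightarrow> real poly \<Rightarrow> real poly"
    by (rule vector_space_poly)
  have open_case: "(\<Sum>i\<in>UNIV. \<alpha> t $ i * poly q (y i)) = poly q t" if t: "t \<in> {-1<..<1}" for t
  proof -
    \<comment> \<open>Both sides are linear in \<open>q\<close>, so the polynomials satisfying the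
      identity form a subspace. On the basis polynomials it is a row of \<Phi> \<alpha> =
      \<psi>.\<close>
    have "q \<in> vs.span (P ` {..n})"
      using P q unfolding is_poly_basis_def by simp
    then show ?thesis
    proof (induction rule: vs.span_induct)
      case base
      then show ?case
        by (auto simp: vs.subspace_def sum.distrib distrib_left sum_distrib_left mult.left_commute)
          (simp flip: sum_distrib_left)
    next
      case (step p)
      then show ?case
        using eq[OF t] by (auto simp: Phi_row_def psi_def inner_vec_def mult.commute)
    qed
  qed
  have "continuous_on {-1..1} (\<lambda>t. (\<Sum>i\<in>UNIV. \<alpha> t $ i * poly q (y i)) - poly q t)"
    by (intro continuous_intros continuous_on_vec_poly_space[OF \<alpha>])
  then show ?thesis
    using continuous_constant_on_closure[of "{-1<..<1}"
        "\<lambda>t. (\<Sum>i\<in>UNIV. \<alpha> t $ i * poly q (y i)) - poly q t" 0 t] open_case t by simp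
qed

lemma snapshot_op_reproduces:
  fixes y :: "'N::finite \<Rightarrow> real"
  assumes rep: "\<And>q t. q \<in> poly_space n \<Longrightarrow> t \<in> {-1..1} \<Longrightarrow>
      (\<Sum>i\<in>UNIV. \<alpha> t $ i * poly q (y i)) = poly q t"
    and y: "\<And>i. y i \<in> {-1..1}"
    and p: "p \<in> vec_poly_space n" and t: "t \<in> {-1..1}"
  shows "snapshot_op \<alpha> y p t = p t"
proof (rule vec_eq_iff[THEN iffD2], rule allI)
  fix k
  obtain q where "q \<in> poly_space n" "\<And>t. t \<in> {-1..1} \<Longrightarrow> p t $ k = poly q t"
    using p unfolding vec_poly_space_def by blast
  then show "snapshot_op \<alpha> y p t $ k = p t $ k"
    using rep[of q t] t y by (simp add: snapshot_op_def)
qed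

subsection \<open>Existence of a best approximation\<close>

lemma best_approx_exists:
  fixes y :: "'N::finite \<Rightarrow> real" and f :: "real \<Rightarrow> real ^ 'm"
  assumes A: "sym_pos_def A"
    and y: "\<And>i. y i \<in> {-1..1}"
    and \<alpha>: "\<alpha> \<in> vec_poly_space n"
    and rep: "\<And>(p :: real \<Rightarrow> real ^ 'm) t. p \<in> vec_poly_space n \<Longrightarrow> t \<in> {-1..1} \<Longrightarrow>
      snapshot_op \<alpha> y p t = p t"
    and f: "continuous_on {-1..1} f"
  obtains p where "p \<in> vec_poly_space n"
    and "\<And>q. q \<in> vec_poly_space n \<Longrightarrow>
      Linf_norm A (\<lambda>t. f t - p t) \<le> Linf_norm A (\<lambda>t. f t - q t)"
proof -
  define p where "p v t = (\<Sum>i\<in>UNIV. \<alpha> t $ i *\<^sub>R v $ i)" for v :: "(real ^ 'm) ^ 'N" and t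
  define E where "E = (\<lambda>q. Linf_norm A (\<lambda>t. f t - q t)) ` vec_poly_space n"
  \<comment> \<open>These are sublevel sets of the error in terms of the values \<open>v\<close>.
    The first family sees \<open>v\<close> only through \<open>p v\<close>, which need not determine
    \<open>v\<close>; the second family controls \<open>v\<close> itself and so makes
    \<open>F r\<close> bounded.\<close>
  define F where "F r = (\<Inter>t\<in>{-1..1}. {v. wnorm A (f t - p v t) \<le> r}) \<inter>
      (\<Inter>i. {v. wnorm A (f (y i) - v $ i) \<le> r})" for r
  have E_iff: "Linf_norm A (\<lambda>t. f t - q t) \<le> r \<longleftrightarrow> (\<forall>t\<in>{-1..1}. wnorm A (f t - q t) \<le> r)"
    if "q \<in> vec_poly_space n" for q r
    by (intro Linf_norm_le_iff A continuous_intros f continuous_on_vec_poly_space[OF that])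
  have p_mem: "p v \<in> vec_poly_space n" for v
  proof -
    have "\<exists>q \<in> poly_space n. \<forall>t\<in>{-1..1}. p v t $ k = poly q t" for k
    proof -
      obtain a where a: "\<And>i. a i \<in> poly_space n" "\<And>i t. t \<in> {-1..1} \<Longrightarrow> \<alpha> t $ i = poly (a i) t"
        using \<alpha> unfolding vec_poly_space_def mem_Collect_eq Bex_def by metis
      have "(\<Sum>i\<in>UNIV. smult (v $ i $ k) (a i)) \<in> poly_space n"
        using a(1) by (auto simp: poly_space_def intro!: degree_sum_le
            intro: order_trans[OF degree_smult_le])
      moreover have "p v t $ k = poly (\<Sum>i\<in>UNIV. smult (v $ i $ k) (a i)) t" if "t \<in> {-1..1}" for t
        using a(2)[OF that] by (simp add: p_def poly_sum mult.commute)
      ultimately show ?thesis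
        by blast
    qed
    then show ?thesis
      by (simp add: vec_poly_space_def)
  qed
  \<comment> \<open>The snapshot values of a polynomial \<open>q\<close> reproduce \<open>q\<close>,
    so for them both families of constraints reduce to the error bound for \<open>q\<close>.\<close>
  have F_mem: "(\<chi> i. q (y i)) \<in> F r"
    if "q \<in> vec_poly_space n" "Linf_norm A (\<lambda>t. f t - q t) \<le> r" for q r
  proof -
    have "p (\<chi> i. q (y i)) t = q t" if "t \<in> {-1..1}" for t
      using rep[OF \<open>q \<in> _\<close> that] by (simp add: p_def snapshot_op_def)
    then show ?thesis
      using that E_iff[OF that(1)] y by (simp add: F_def)
  qed
  have "compact (F r)" for r
  proof (rule compact_eq_bounded_closed[THEN iffD2], rule conjI)
    obtain c where c: "c > 0" "\<And>z. norm z \<le> c * wnorm A z"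
      using norm_le_wnorm[OF A] by blast
    have "norm v \<le> (\<Sum>i\<in>UNIV. norm (f (y i)) + c * r)" if "v \<in> F r" for v
    proof -
      have "norm (v $ i) \<le> norm (f (y i)) + c * r" for i
      proof -
        have "norm (f (y i) - v $ i) \<le> c * r"
          using c(2)[of "f (y i) - v $ i"] c(1) that
          by (fastforce simp: F_def intro: order_trans mult_left_mono)
        then show ?thesis
          using norm_triangle_sub[of "v $ i" "f (y i)"] by (simp add: norm_minus_commute)
      qed
      then have "(\<Sum>i\<in>UNIV. norm (v $ i)) \<le> (\<Sum>i\<in>UNIV. norm (f (y i)) + c * r)"
        by (intro sum_mono)
      then show ?thesis
        using L2_set_le_sum[of UNIV "\<lambda>i. norm (v $ i)"] by (simp add: norm_vec_def)
    qed
    then show "bounded (F r)"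
      by (rule boundedI)
    show "closed (F r)"
      unfolding F_def p_def
      by (intro closed_Int closed_INT ballI closed_Collect_le continuous_intros)
  qed
  moreover have "F r \<subseteq> F r'" if "r \<le> r'" for r r'
    unfolding F_def using that by (auto intro: order_trans)
  moreover have "F r \<noteq> {}" if "Inf E < r" for r
  proof -
    have "\<exists>x\<in>E. x < r"
      using that p_mem by (intro cInf_lessD) (auto simp: E_def)
    then obtain q where "q \<in> vec_poly_space n" "Linf_norm A (\<lambda>t. f t - q t) \<le> r"
      unfolding E_def using less_imp_le by blast
    from F_mem[OF this] show ?thesis
      by (rule ex_in_conv[THEN iffD1, OF exI])
  qed
  \<comment> \<open>The levels decrease to the infimum of the errors. The corresponding compact sets
    are nested and nonempty, so they share a point \<open>v\<close>; letting \<open>k\<close> tend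
    to infinity shows that \<open>p v\<close> attains the infimum.\<close>
  ultimately have "(\<Inter>k. F (Inf E + inverse (real (Suc k)))) \<noteq> {}"
    by (intro compact_nest) (simp_all add: le_imp_inverse_le)
  then obtain v where v: "\<And>k. v \<in> F (Inf E + inverse (real (Suc k)))"
    by auto
  have "wnorm A (f t - p v t) \<le> Inf E" if "t \<in> {-1..1}" for t
    using v that LIMSEQ_inverse_real_of_nat_add[of "Inf E"]
    by (intro LIMSEQ_le_const) (auto simp: F_def)
  then have "Linf_norm A (\<lambda>t. f t - p v t) \<le> Inf E"
    by (simp add: E_iff p_mem)
  \<comment> \<open>Without a lower bound, \<open>Inf E\<close> need not lie below the elements of
    \<open>E\<close>. Evaluating the error at 0 shows that every element is nonnegative.\<close>
  moreover have "bdd_below E"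
  proof (rule bdd_belowI)
    fix x assume "x \<in> E"
    then obtain q where q: "q \<in> vec_poly_space n" "x = Linf_norm A (\<lambda>t. f t - q t)"
      by (auto simp: E_def)
    then have "wnorm A (f 0 - q 0) \<le> x"
      using E_iff[OF q(1), of x] by simp
    then show "0 \<le> x"
      using wnorm_nonneg[OF A] order_trans by blast
  qed
  ultimately have "Linf_norm A (\<lambda>t. f t - p v t) \<le> Linf_norm A (\<lambda>t. f t - q t)"
    if "q \<in> vec_poly_space n" for q
    using that cInf_lower[of "Linf_norm A (\<lambda>t. f t - q t)" E] by (simp add: E_def)
  with p_mem show thesis
    by (rule that)
qed

text \<open>The \<open>LEAST\<close> in \<open>best_approx_error\<close> denotes a minimum only once
  a minimizer is known. From here on the best error is used solely as a pointwise bound.\<close>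

lemma best_approx_errorE:
  fixes y :: "'N::finite \<Rightarrow> real" and f :: "real \<Rightarrow> real ^ 'm"
  assumes A: "sym_pos_def A"
    and y: "\<And>i. y i \<in> {-1..1}"
    and \<alpha>: "\<alpha> \<in> vec_poly_space n"
    and rep: "\<And>(p :: real \<Rightarrow> real ^ 'm) t. p \<in> vec_poly_space n \<Longrightarrow> t \<in> {-1..1} \<Longrightarrow>
      snapshot_op \<alpha> y p t = p t"
    and f: "continuous_on {-1..1} f"
  obtains p where "p \<in> vec_poly_space n"
    and "\<And>t. t \<in> {-1..1} \<Longrightarrow> wnorm A (f t - p t) \<le> best_approx_error A n f"
proof -
  obtain p where p: "p \<in> vec_poly_space n" "\<And>q. q \<in> vec_poly_space n \<Longrightarrow>
      Linf_norm A (\<lambda>t. f t - p t) \<le> Linf_norm A (\<lambda>t. f t - q t)"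
    using best_approx_exists[OF A y \<alpha> rep f] by blast
  have "best_approx_error A n f = Linf_norm A (\<lambda>t. f t - p t)"
    unfolding best_approx_error_def by (rule Least_equality) (use p in auto)
  moreover have "\<forall>t\<in>{-1..1}. wnorm A (f t - p t) \<le> Linf_norm A (\<lambda>t. f t - p t)"
    using Linf_norm_le_iff[OF A continuous_on_diff[OF f continuous_on_vec_poly_space[OF p(1)]]] by blast
  ultimately show thesis
    using that[OF p(1)] by simp
qed

subsection \<open>The error estimate\<close>

lemma weight_matrix_inv_nth:
  fixes w :: "'N::finite \<Rightarrow> real"
  assumes w: "\<And>i. w i > 0"
  shows "(matrix_inv (weight_matrix w) *v a) $ i = a $ i / sqrt (w i)"
proof -
  have mult: "(weight_matrix v ** B) $ i $ j = sqrt (v i) * B $ i $ j"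
    for v and B :: "real ^ 'N ^ 'N" and i j
    by (simp add: weight_matrix_def matrix_matrix_mult_def if_distrib[of "\<lambda>x. x * _"] cong: if_cong)
  have "weight_matrix v ** weight_matrix (\<lambda>i. inverse (v i)) = mat 1"
    if "\<And>i. v i > 0" for v :: "'N \<Rightarrow> real"
    unfolding vec_eq_iff mult using that
    by (auto simp: weight_matrix_def mat_def less_imp_neq[OF that, symmetric] simp flip: real_sqrt_mult)
  \<comment> \<open>The identity for \<open>w\<close> gives a right inverse and the one for the
    reciprocal weights a left inverse. As \<open>matrix_inv\<close> is defined by choice,
    invertibility has to come first.\<close>
  from this[of w] this[of "\<lambda>i. inverse (w i)"] have "invertible (weight_matrix w)"
    using w unfolding invertible_def by (intro exI[of _ "weight_matrix (\<lambda>i. inverse (w i))"]) simp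
  then have "weight_matrix w ** matrix_inv (weight_matrix w) = mat 1"
    unfolding invertible_def matrix_inv_def by (metis (mono_tags, lifting) someI_ex)
  then have "weight_matrix w *v (matrix_inv (weight_matrix w) *v a) = a"
    by (simp add: matrix_vector_mul_assoc)
  moreover have "(weight_matrix w *v x) $ i = sqrt (w i) * x $ i" for x
    by (simp add: weight_matrix_def matrix_vector_mult_def if_distrib[of "\<lambda>x. x * _"] cong: if_cong)
  ultimately have "sqrt (w i) * (matrix_inv (weight_matrix w) *v a) $ i = a $ i"
    by metis
  then show ?thesis
    using w[of i] by (simp add: field_simps)
qed

lemma sum_abs_le_weighted:
  fixes w :: "'N::finite \<Rightarrow> real"
  assumes w: "\<And>i. w i > 0"
  shows "(\<Sum>i\<in>UNIV. \<bar>a $ i\<bar>)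
    \<le> sqrt (\<Sum>i\<in>UNIV. w i) * norm (matrix_inv (weight_matrix w) *v a)"
proof (rule power2_le_imp_le)
  let ?b = "matrix_inv (weight_matrix w) *v a"
  have "(\<Sum>i\<in>UNIV. \<bar>a $ i\<bar>)\<^sup>2 = (\<Sum>i\<in>UNIV. sqrt (w i) * \<bar>?b $ i\<bar>)\<^sup>2"
    by (simp add: weight_matrix_inv_nth[OF w] abs_divide less_imp_neq[OF w, symmetric] w less_imp_le)
  also have "\<dots> \<le> (\<Sum>i\<in>UNIV. (sqrt (w i))\<^sup>2) * (\<Sum>i\<in>UNIV. \<bar>?b $ i\<bar>\<^sup>2)"
    by (rule Cauchy_Schwarz_ineq_sum)
  also have "\<dots> = (sqrt (\<Sum>i\<in>UNIV. w i) * norm ?b)\<^sup>2"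
    using w by (simp add: power_mult_distrib norm_vec_def L2_set_def sum_nonneg less_imp_le)
  finally show "(\<Sum>i\<in>UNIV. \<bar>a $ i\<bar>)\<^sup>2 \<le> (sqrt (\<Sum>i\<in>UNIV. w i) * norm ?b)\<^sup>2" .
  show "0 \<le> sqrt (\<Sum>i\<in>UNIV. w i) * norm ?b"
    using w by (simp add: sum_nonneg less_imp_le)
qed

text \<open>The sum of the \<open>\<bar>\<alpha> t $ i\<bar>\<close> is the Lebesgue function of the
  operator at \<open>t\<close>; it bounds the amplification of the snapshot values.\<close>

lemma wnorm_snapshot_op_le:
  fixes w y :: "'N::finite \<Rightarrow> real"
  assumes A: "sym_pos_def A" and w: "\<And>i. w i > 0"
    and M: "\<And>i. wnorm A (g (y i)) \<le> M"
  shows "wnorm A (snapshot_op \<alpha> y g t)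
    \<le> sqrt (\<Sum>i\<in>UNIV. w i) * norm (matrix_inv (weight_matrix w) *v \<alpha> t) * M"
proof -
  have "0 \<le> M"
    using M wnorm_nonneg[OF A] order_trans by blast
  have "wnorm A (snapshot_op \<alpha> y g t) \<le> (\<Sum>i\<in>UNIV. \<bar>\<alpha> t $ i\<bar> * wnorm A (g (y i)))"
    unfolding snapshot_op_def using wnorm_sum[OF A] by (metis (mono_tags, lifting) sum.cong wnorm_scaleR)
  also have "\<dots> \<le> (\<Sum>i\<in>UNIV. \<bar>\<alpha> t $ i\<bar>) * M"
    unfolding sum_distrib_right by (intro sum_mono mult_left_mono M) simp
  also have "\<dots> \<le> sqrt (\<Sum>i\<in>UNIV. w i) * norm (matrix_inv (weight_matrix w) *v \<alpha> t) * M"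
    by (intro mult_right_mono sum_abs_le_weighted w \<open>0 \<le> M\<close>)
  finally show ?thesis .
qed

text \<open>The parameter \<open>s\<close> comes from \<open>2 a b \<le> s a\<^sup>2 + b\<^sup>2 / s\<close>; choosing it as the square root of the bound
  on the integral of \<open>b\<^sup>2\<close> makes the integrated inequality as sharp as Minkowski's.\<close>

lemma power2_sum_le_weighted:
  fixes a b s :: real
  assumes "s > 0"
  shows "(a + b)\<^sup>2 \<le> (1 + s) * a\<^sup>2 + (1 + 1 / s) * b\<^sup>2"
proof -
  have "0 \<le> (s * a - b)\<^sup>2 / s"
    using assms by simp
  also have "\<dots> = s * a\<^sup>2 - 2 * a * b + b\<^sup>2 / s"
    using assms by (simp add: power2_eq_square field_simps)
  finally show ?thesis
    by (simp add: power2_sum algebra_simps)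
qed

theorem corollary4p1:
  fixes n :: nat
    and A\<^sub>0 :: "real ^ 'm ^ 'm"
    and y w :: "'N::finite \<Rightarrow> real"
    and e :: real
    and P :: "nat \<Rightarrow> real poly"
    and \<alpha> :: "real \<Rightarrow> real ^ 'N"
    and f :: "real \<Rightarrow> real ^ 'm"
  assumes "sym_pos_def A\<^sub>0"
    and "\<And>i. y i \<in> {-1<..<1}"
    and "\<And>i. w i > 0"
    and "inner_product_on (poly_space n) (discrete_form y w)"
    and "(\<Sum>i\<in>UNIV. w i) = 2"
    and "e = quad_error n y w"
    and "e < 1"
    and "normalized_orthogonal_basis n y w P"
    and "\<alpha> \<in> vec_poly_space n"
    and "\<And>t j. t \<in> {-1<..<1} \<Longrightarrow> j \<le> n \<Longrightarrow> Phi_row P y j \<bullet> \<alpha> t = psi P t j"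
    and "(LINT t:{-1..1}|lborel. (norm (matrix_inv (weight_matrix w) *v \<alpha> t))\<^sup>2)
           \<le> (real n + 1) / (1 - e)"
    and "continuous_on {-1..1} f"
  shows "L2_norm A\<^sub>0 (\<lambda>t. f t - snapshot_op \<alpha> y f t)
           \<le> (sqrt 2 + C_s n e) * best_approx_error A\<^sub>0 n f"
proof -
  note A = \<open>sym_pos_def A\<^sub>0\<close> and w = \<open>\<And>i. w i > 0\<close> and \<alpha> = \<open>\<alpha> \<in> vec_poly_space n\<close>
    and f = \<open>continuous_on {-1..1} f\<close>
  have y: "y i \<in> {-1..1}" for i
    using assms(2)[of i] by simp
  have "is_poly_basis n P"
    using assms(8) by (simp add: normalized_orthogonal_basis_def)
  note rep_poly = reproduces_poly[OF this \<alpha> assms(10)]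
  have rep: "snapshot_op \<alpha> y p t = p t"
    if "p \<in> vec_poly_space n" "t \<in> {-1..1}" for p :: "real \<Rightarrow> real ^ 'm" and t
    using snapshot_op_reproduces[of n \<alpha> y] rep_poly y that by blast
  define M where "M = best_approx_error A\<^sub>0 n f"
  obtain p where p: "p \<in> vec_poly_space n"
    and M: "\<And>t. t \<in> {-1..1} \<Longrightarrow> wnorm A\<^sub>0 (f t - p t) \<le> M"
    unfolding M_def using best_approx_errorE[OF A y \<alpha> rep f] by blast
  have "0 \<le> M"
    using M[of 0] wnorm_nonneg[OF A, of "f 0 - p 0"] by simp
  define \<beta> where "\<beta> t = norm (matrix_inv (weight_matrix w) *v \<alpha> t)" for t
  define err where "err t = wnorm A\<^sub>0 (f t - snapshot_op \<alpha> y f t)" for t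
  have pointwise: "err t \<le> M * (1 + sqrt 2 * \<beta> t)" if t: "t \<in> {-1..1}" for t
  proof -
    let ?g = "\<lambda>t. f t - p t"
    have "snapshot_op \<alpha> y ?g t = snapshot_op \<alpha> y f t - p t"
      using rep[OF p t] by (simp add: snapshot_op_def scaleR_diff_right sum_subtractf)
    then have "err t = wnorm A\<^sub>0 (?g t - snapshot_op \<alpha> y ?g t)"
      by (simp add: err_def)
    also have "\<dots> \<le> wnorm A\<^sub>0 (?g t) + wnorm A\<^sub>0 (snapshot_op \<alpha> y ?g t)"
      by (rule wnorm_triangle_diff[OF A])
    also have "\<dots> \<le> M + sqrt 2 * \<beta> t * M"
      using wnorm_snapshot_op_le[of A\<^sub>0 w ?g y M \<alpha> t] A w M[OF y] M[OF t]
      by (intro add_mono) (simp_all add: \<beta>_def assms(5))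
    finally show ?thesis
      by (simp add: algebra_simps)
  qed
  define s where "s = sqrt ((real n + 1) / (1 - e))"
  have s: "s > 0" "s\<^sup>2 = (real n + 1) / (1 - e)"
    using \<open>e < 1\<close> by (simp_all add: s_def)
  have cont_\<beta>: "continuous_on {-1..1} \<beta>"
    unfolding \<beta>_def
    by (intro continuous_intros continuous_on_vec_poly_space[OF \<alpha>]
        bounded_linear.continuous_on[OF matrix_vector_mul_bounded_linear])
  have cont_err: "continuous_on {-1..1} err"
    unfolding err_def
    by (intro continuous_intros f continuous_on_vec_poly_space[OF snapshot_op_in_vec_poly_space[OF \<alpha>]])
  have "(LINT t:{-1..1}|lborel. (err t)\<^sup>2)
      \<le> (LINT t:{-1..1}|lborel. M\<^sup>2 * (1 + s) + M\<^sup>2 * (2 * (1 + 1 / s)) * (\<beta> t)\<^sup>2)"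
  proof (rule set_integral_mono)
    fix t :: real assume t: "t \<in> {-1..1}"
    have "(err t)\<^sup>2 \<le> (M * (1 + sqrt 2 * \<beta> t))\<^sup>2"
      using pointwise[OF t] wnorm_nonneg[OF A] by (intro power_mono) (auto simp: err_def)
    also have "\<dots> \<le> M\<^sup>2 * ((1 + s) * 1\<^sup>2 + (1 + 1 / s) * (sqrt 2 * \<beta> t)\<^sup>2)"
      unfolding power_mult_distrib[of M]
      by (intro mult_left_mono power2_sum_le_weighted s) simp
    finally show "(err t)\<^sup>2 \<le> M\<^sup>2 * (1 + s) + M\<^sup>2 * (2 * (1 + 1 / s)) * (\<beta> t)\<^sup>2"
      by (simp add: power_mult_distrib algebra_simps)
  qed (intro borel_integrable_atLeastAtMost' continuous_intros cont_err cont_\<beta>)+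
  \<comment> \<open>The leading 2 is the length of the interval, whereas the 2 in the coefficient of
    \<open>(\<beta> t)\<^sup>2\<close> comes from the total weight.\<close>
  also have "\<dots> = 2 * (M\<^sup>2 * (1 + s)) + M\<^sup>2 * (2 * (1 + 1 / s)) * (LINT t:{-1..1}|lborel. (\<beta> t)\<^sup>2)"
  proof -
    have "set_integrable lborel {-1..1} (\<lambda>t. (\<beta> t)\<^sup>2)"
      by (intro borel_integrable_atLeastAtMost' continuous_intros cont_\<beta>)
    then show ?thesis
      by (subst set_integral_add)
        (simp_all add: set_integral_const borel_integrable_atLeastAtMost' set_integrable_mult_right)
  qed
  also have "\<dots> \<le> 2 * (M\<^sup>2 * (1 + s)) + M\<^sup>2 * (2 * (1 + 1 / s)) * s\<^sup>2"
    using assms(11) s by (intro add_left_mono mult_left_mono) (simp_all add: \<beta>_def)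
  \<comment> \<open>The choice of \<open>s\<close> gives a perfect square, as
    \<open>(1 + s) + (1 + 1 / s) * s\<^sup>2 = (1 + s)\<^sup>2\<close>.\<close>
  also have "\<dots> = ((sqrt 2 + sqrt 2 * s) * M)\<^sup>2"
    using s(1) by (simp add: power2_eq_square field_simps)
  finally have "L2_norm A\<^sub>0 (\<lambda>t. f t - snapshot_op \<alpha> y f t) \<le> \<bar>(sqrt 2 + sqrt 2 * s) * M\<bar>"
    unfolding L2_norm_def err_def by (metis real_sqrt_abs real_sqrt_le_mono)
  moreover have "sqrt 2 * s = C_s n e"
    by (simp add: s_def C_s_def algebra_simps flip: real_sqrt_mult)
  moreover have "\<bar>(sqrt 2 + sqrt 2 * s) * M\<bar> = (sqrt 2 + sqrt 2 * s) * M"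
    using s(1) \<open>0 \<le> M\<close> by simp
  ultimately show ?thesis
    by (simp add: M_def)
qed

end
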